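(* There exist absolute constants $c_1,c_2>0$ such that for every $n\geq1$ and every $p\geq1$, $$c_1\,n(\log n+p)\ \leq\ \|\Lambda_{B_2^n}^*\|_{L^p(\mu_{B_2^n})}\ \leq\ c_2\,n(\log n+p).$$
   Context: $B_2^n$ is the Euclidean unit ball in $\mathbb{R}^n$, $\mu_{B_2^n}$ the uniform probability measure on it, and $\Lambda_{B_2^n}^*(x)=\sup_{\theta\in\mathbb{R}^n}\{\langle\theta,x\rangle-\log\int e^{\langle\theta,y\rangle}\,d\mu_{B_2^n}(y)\}$ its Cramér transform. $\|f\|_{L^p(\mu)}=(\int|f|^p\,d\mu)^{1/p}$. *)

theory Defs
  imports "HOL-Analysis.Analysis"
begin

text \<open>
  The constants of the theorem must not depend on the dimension, so the dimension has to be a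
  bound variable of the formula and cannot be a type.  A point of \<open>n\<close>-dimensional space is
  therefore an extensional function on \<open>{..<n}\<close>, and Lebesgue measure is the product measure,
  as in the ball-volume computation of the library.
\<close>

definition lborel_n :: "nat \<Rightarrow> (nat \<Rightarrow> real) measure" where
  "lborel_n n = Pi\<^sub>M {..<n} (\<lambda>_. lborel)"

definition inner_n :: "nat \<Rightarrow> (nat \<Rightarrow> real) \<Rightarrow> (nat \<Rightarrow> real) \<Rightarrow> real" where
  "inner_n n x y = (\<Sum>i<n. x i * y i)"

definition ball2 :: "nat \<Rightarrow> (nat \<Rightarrow> real) set" where
  "ball2 n = {x \<in> space (lborel_n n). sqrt (inner_n n x x) \<le> 1}"

definition ball_measure :: "nat \<Rightarrow> (nat \<Rightarrow> real) measure" where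
  "ball_measure n = uniform_measure (lborel_n n) (ball2 n)"

text \<open>
  The Bochner integral of a non-integrable function is \<open>0\<close>; the case distinction gives the
  logarithmic Laplace transform its usual value \<open>\<infinity>\<close> there.
\<close>

definition log_laplace :: "nat \<Rightarrow> (nat \<Rightarrow> real) measure \<Rightarrow> (nat \<Rightarrow> real) \<Rightarrow> ereal" where
  "log_laplace n \<mu> \<theta> =
     (if integrable \<mu> (\<lambda>y. exp (inner_n n \<theta> y))
      then ereal (ln (\<integral>y. exp (inner_n n \<theta> y) \<partial>\<mu>)) else \<infinity>)"

text \<open>
  Extended-real valued: the Cramer transform of the uniform measure on the ball is \<open>\<infinity>\<close>
  on the unit sphere, whereas an unbounded supremum in \<^typ>\<open>real\<close> would be unspecified.
\<close>

definition cramer_transform :: "nat \<Rightarrow> (nat \<Rightarrow> real) measure \<Rightarrow> (nat \<Rightarrow> real) \<Rightarrow> ereal" where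
  "cramer_transform n \<mu> x =
     (SUP \<theta> \<in> space (lborel_n n). ereal (inner_n n \<theta> x) - log_laplace n \<mu> \<theta>)"

text \<open>Real powers of extended nonnegative reals; only exponents \<open>p > 0\<close> are meaningful.\<close>

definition ennreal_powr :: "ennreal \<Rightarrow> real \<Rightarrow> ennreal" where
  "ennreal_powr x p = (if x = \<infinity> then \<infinity> else ennreal (enn2real x powr p))"

definition Lp_norm :: "real \<Rightarrow> 'a measure \<Rightarrow> ('a \<Rightarrow> ereal) \<Rightarrow> ennreal" where
  "Lp_norm p \<mu> f = ennreal_powr (\<integral>\<^sup>+x. ennreal_powr (e2ennreal \<bar>f x\<bar>) p \<partial>\<mu>) (1 / p)"

lemma emeasure_ball2: "emeasure (lborel_n n) (ball2 n) = ennreal (unit_ball_vol (real n))"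
proof -
  have "ball2 n = {f. sqrt (\<Sum>i<n. (f i)\<^sup>2) \<le> 1} \<inter> space (Pi\<^sub>M {..<n} (\<lambda>_. lborel))"
    by (auto simp: ball2_def lborel_n_def inner_n_def power2_eq_square)
  then show ?thesis
    using emeasure_cball_aux[of "{..<n}" 1] by (simp add: lborel_n_def)
qed

end

theory Submission
  imports Defs "HOL-Probability.Distributions"
begin

text \<open>
  Write \<open>r\<close> for the Euclidean length of \<open>x\<close> in the ball. Up to constant factors and an additive
  error of order \<open>n\<close>, the Cramer transform at \<open>x\<close> is \<open>n * ln (1 / (1 - r))\<close>, and \<open>1 - r\<close> behaves
  under the uniform measure like an exponential variable divided by \<open>n\<close>. So the transform is of
  order \<open>n * ln n\<close> plus \<open>n\<close> times a variable with an exponential upper tail, whose \<open>p\<close>-norm grows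
  linearly in \<open>p\<close>.

  Both pointwise bounds come from integrals that factor over the coordinates. For the upper bound
  (\<open>cramer_transform_le\<close>), the Laplace transform at \<open>\<theta>\<close> is at least \<open>exp (inner_n n \<theta> x)\<close> times the
  mass of a small box that has a corner at \<open>x\<close>, lies in the ball, and on which the exponent is at
  least its value at \<open>x\<close>. For the lower bound (\<open>cramer_transform_ge\<close>), the inequality
  \<open>2 * inner_n n u y \<le> 2 - \<bar>y - u\<bar>\<^sup>2\<close> for a unit vector \<open>u\<close> and \<open>y\<close> in the ball dominates the
  Laplace transform by a Gaussian integral. The volume of the ball enters only through the bounds
  \<open>(1 / sqrt n) ^ n\<close> and \<open>(5 / sqrt n) ^ n\<close>.

  The set \<open>1 - \<delta> < r\<close> has probability \<open>1 - (1 - \<delta>) ^ n\<close>. For the lower bound on the norm, Markov's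
  inequality is applied on the shell with \<open>\<delta> = exp (-8 * p) / n\<close> (\<open>Lp_norm_cramer_ge\<close>). For the
  upper bound, the \<open>p\<close>-th moment is reduced to the expectation of \<open>1 / sqrt (1 - r)\<close>, which is at
  most \<open>5 * n\<close> (\<open>Lp_norm_cramer_le\<close>).
\<close>

section \<open>The uniform measure on the ball\<close>

lemma ball2_L2_set: "ball2 n = {x \<in> space (lborel_n n). L2_set x {..<n} \<le> 1}"
  by (simp add: ball2_def inner_n_def L2_set_def power2_eq_square)

lemma L2_set_measurable [measurable]: "(\<lambda>x. L2_set x {..<n}) \<in> borel_measurable (lborel_n n)"
  unfolding lborel_n_def L2_set_def by measurable

lemma inner_n_measurable [measurable]: "inner_n n \<theta> \<in> borel_measurable (lborel_n n)"
  unfolding lborel_n_def inner_n_def[abs_def] by measurable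

lemma ball2_sets [measurable]: "ball2 n \<in> sets (lborel_n n)"
  unfolding ball2_L2_set by measurable

lemma space_ball_measure [simp]: "space (ball_measure n) = space (lborel_n n)"
  and sets_ball_measure [simp, measurable_cong]: "sets (ball_measure n) = sets (lborel_n n)"
  by (simp_all add: ball_measure_def)

lemma unit_ball_vol_of_nat_pos: "unit_ball_vol (real n) > 0"
  by (rule unit_ball_vol_pos) simp

lemma unit_ball_vol_of_nat_nonzero: "unit_ball_vol (real n) \<noteq> 0"
  using unit_ball_vol_of_nat_pos[of n] by linarith

lemma prob_space_ball_measure: "prob_space (ball_measure n)"
  unfolding ball_measure_def
  by (rule prob_space_uniform_measure) (use unit_ball_vol_of_nat_pos[of n] in \<open>simp_all add: emeasure_ball2 ennreal_eq_0_iff not_le\<close>)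

lemma AE_ball_measure: "AE x in ball_measure n. x \<in> ball2 n"
  unfolding ball_measure_def by (rule AE_uniform_measureI) auto

lemma nn_integral_ball_measure:
  assumes "f \<in> borel_measurable (lborel_n n)"
  shows "(\<integral>\<^sup>+x. f x \<partial>ball_measure n) =
    (\<integral>\<^sup>+x. f x * indicator (ball2 n) x \<partial>lborel_n n) / ennreal (unit_ball_vol (real n))"
  unfolding ball_measure_def by (subst nn_integral_uniform_measure) (use assms in \<open>auto simp: emeasure_ball2\<close>)

section \<open>The volume of the unit ball up to a factor exponential in the dimension\<close>

lemma product_sigma_finite_lborel: "product_sigma_finite (\<lambda>_::nat. lborel :: real measure)"
  by standard

lemma emeasure_box:
  assumes "h \<ge> 0" "\<And>i. i < n \<Longrightarrow> b i - a i = h"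
  shows "emeasure (lborel_n n) (PiE {..<n} (\<lambda>i. {a i..b i})) = ennreal (h ^ n)"
proof -
  interpret product_sigma_finite "\<lambda>_::nat. lborel :: real measure"
    by (rule product_sigma_finite_lborel)
  have "emeasure (lborel_n n) (PiE {..<n} (\<lambda>i. {a i..b i})) = (\<Prod>i<n. emeasure lborel {a i..b i})"
    unfolding lborel_n_def by (rule emeasure_PiM) auto
  also have "\<dots> = (\<Prod>i<n. ennreal h)"
  proof (rule prod.cong[OF refl])
    fix i assume "i \<in> {..<n}"
    with assms(2)[of i] assms(1) have "a i \<le> b i" "b i - a i = h" by auto
    then show "emeasure lborel {a i..b i} = ennreal h" by simp
  qed
  finally show ?thesis using assms(1) by (simp add: ennreal_power)
qed

lemma box_sets [measurable]: "PiE {..<n} (\<lambda>i. {a i..b i::real}) \<in> sets (lborel_n n)"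
  unfolding lborel_n_def by (rule sets_PiM_I_finite) auto

text \<open>
  A point at distance \<open>1 - r\<close> from the sphere carries a cube of side about \<open>(1 - r) / sqrt n\<close>
  inside the ball, since the diagonal of a cube is \<open>sqrt n\<close> times its side. The one-sided boxes
  allowed here let a corner of the cube be placed at the point.
\<close>

lemma box_subset_ball2:
  assumes "n \<ge> 1" "L2_set x {..<n} \<le> 1"
    and "h = (1 - L2_set x {..<n}) / sqrt (real n)"
    and "\<And>i. i < n \<Longrightarrow> x i - h \<le> a i \<and> b i \<le> x i + h"
  shows "PiE {..<n} (\<lambda>i. {a i..b i}) \<subseteq> ball2 n"
proof
  fix y assume y: "y \<in> PiE {..<n} (\<lambda>i. {a i..b i})"
  have h0: "h \<ge> 0" using assms by simp
  have d: "\<bar>y i - x i\<bar> \<le> h" if "i < n" for i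
  proof -
    have "a i \<le> y i" "y i \<le> b i" using y that by (auto simp: PiE_iff)
    with assms(4)[OF that] show ?thesis by linarith
  qed
  have "L2_set y {..<n} = L2_set (\<lambda>i. x i + (y i - x i)) {..<n}" by simp
  also have "\<dots> \<le> L2_set x {..<n} + L2_set (\<lambda>i. y i - x i) {..<n}" by (rule L2_set_triangle_ineq)
  also have "L2_set (\<lambda>i. y i - x i) {..<n} = L2_set (\<lambda>i. \<bar>y i - x i\<bar>) {..<n}"
    by (simp add: L2_set_def)
  also have "\<dots> \<le> L2_set (\<lambda>i. h) {..<n}" by (rule L2_set_mono) (use d in auto)
  also have "\<dots> = 1 - L2_set x {..<n}" using h0 assms(1,2,3) by (simp add: L2_set_constant)
  finally show "y \<in> ball2 n" using y by (auto simp: ball2_L2_set lborel_n_def space_PiM PiE_iff)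
qed

text \<open>
  The volume is of order \<open>(C / sqrt n) ^ n\<close>. The lower bound comes from an inscribed cube. The
  upper bound, \<open>unit_ball_vol_le\<close> below, comes from comparing the indicator of the ball with the
  Gaussian of variance \<open>1 / n\<close> in each coordinate, whose weight on the ball is at least
  \<open>exp (- n / 2)\<close>. A factor exponential in \<open>n\<close> is harmless, because its logarithm is absorbed
  by the term \<open>n * p\<close>.
\<close>

lemma unit_ball_vol_ge:
  assumes "n \<ge> 1" shows "(1 / sqrt (real n)) ^ n \<le> unit_ball_vol (real n)"
proof -
  have "ennreal ((1 / sqrt (real n)) ^ n) =
      emeasure (lborel_n n) (PiE {..<n} (\<lambda>i. {0..1 / sqrt (real n)}))"
    by (rule emeasure_box[symmetric]) auto
  also have "\<dots> \<le> emeasure (lborel_n n) (ball2 n)"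
    by (intro emeasure_mono ball2_sets box_subset_ball2[where x = "\<lambda>_. 0"])
       (use assms in \<open>auto simp: L2_set_constant\<close>)
  finally show ?thesis using unit_ball_vol_of_nat_pos[of n] by (simp add: emeasure_ball2)
qed

lemma nn_integral_gaussian:
  fixes s u :: real
  assumes "s > 0"
  shows "(\<integral>\<^sup>+x. ennreal (exp (- (s * (x - u)\<^sup>2 / 2))) \<partial>lborel) = ennreal (sqrt (2 * pi / s))"
proof -
  interpret prob_space "density lborel (normal_density u (1 / sqrt s))"
    using assms by (intro prob_space_normal_density) auto
  have eq: "ennreal (exp (- (s * (x - u)\<^sup>2 / 2))) =
      ennreal (sqrt (2 * pi / s)) * ennreal (normal_density u (1 / sqrt s) x)" for x
    using assms by (subst ennreal_mult[symmetric])
      (auto simp: normal_density_def power_divide real_sqrt_mult real_sqrt_divide field_simps)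
  have "(\<integral>\<^sup>+x. ennreal (normal_density u (1 / sqrt s) x) \<partial>lborel) = 1"
    using emeasure_space_1 by (simp add: emeasure_density)
  then show ?thesis by (subst eq) (simp add: nn_integral_cmult)
qed

lemma nn_integral_gaussian_n:
  fixes s :: real
  assumes "s > 0"
  shows "(\<integral>\<^sup>+y. ennreal (exp (- (s * (\<Sum>i<n. (y i - u i)\<^sup>2) / 2))) \<partial>lborel_n n) =
    ennreal (sqrt (2 * pi / s) ^ n)"
proof -
  interpret product_sigma_finite "\<lambda>_::nat. lborel :: real measure"
    by (rule product_sigma_finite_lborel)
  have "(\<integral>\<^sup>+y. ennreal (exp (- (s * (\<Sum>i<n. (y i - u i)\<^sup>2) / 2))) \<partial>lborel_n n) =
      (\<integral>\<^sup>+y. (\<Prod>i<n. ennreal (exp (- (s * (y i - u i)\<^sup>2 / 2)))) \<partial>lborel_n n)"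
    by (simp add: prod_ennreal exp_sum[symmetric] sum_distrib_left sum_negf sum_divide_distrib)
  also have "\<dots> = (\<Prod>i<n. ennreal (sqrt (2 * pi / s)))"
    unfolding lborel_n_def
    by (subst product_nn_integral_prod) (use assms in \<open>auto simp: nn_integral_gaussian\<close>)
  finally show ?thesis using assms by (simp add: ennreal_power)
qed

lemma unit_ball_vol_le:
  assumes "n \<ge> 1" shows "unit_ball_vol (real n) \<le> (5 / sqrt (real n)) ^ n"
proof -
  have "ennreal (unit_ball_vol (real n)) = (\<integral>\<^sup>+y. indicator (ball2 n) y \<partial>lborel_n n)"
    by (simp add: emeasure_ball2)
  also have "\<dots> \<le> (\<integral>\<^sup>+y. ennreal (exp (real n / 2)) *
      ennreal (exp (- (real n * (\<Sum>i<n. (y i - 0)\<^sup>2) / 2))) \<partial>lborel_n n)"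
  proof (rule nn_integral_mono)
    fix y assume "y \<in> space (lborel_n n)"
    show "indicator (ball2 n) y \<le> ennreal (exp (real n / 2)) *
      ennreal (exp (- (real n * (\<Sum>i<n. (y i - 0)\<^sup>2) / 2)))"
    proof (cases "y \<in> ball2 n")
      case True
      then have "(\<Sum>i<n. (y i)\<^sup>2) \<le> 1" by (simp add: ball2_L2_set L2_set_def)
      then have "real n / 2 * (\<Sum>i<n. (y i)\<^sup>2) \<le> real n / 2 * 1" by (intro mult_left_mono) auto
      then have "1 \<le> exp (real n / 2 + - (real n * (\<Sum>i<n. (y i - 0)\<^sup>2) / 2))" by simp
      then show ?thesis using True by (simp add: ennreal_mult[symmetric] exp_add[symmetric])
    qed simp
  qed
  also have "\<dots> = ennreal (exp (real n / 2)) * ennreal (sqrt (2 * pi / real n) ^ n)"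
    using assms nn_integral_gaussian_n[of "real n" n "\<lambda>_. 0"]
    by (subst nn_integral_cmult) (auto simp: lborel_n_def)
  also have "\<dots> = ennreal ((exp (1/2) * sqrt (2 * pi / real n)) ^ n)"
    by (simp add: ennreal_mult[symmetric] power_mult_distrib exp_of_nat_mult[symmetric])
  finally have "unit_ball_vol (real n) \<le> (exp (1/2) * sqrt (2 * pi / real n)) ^ n"
    by (simp add: ennreal_le_iff)
  also have "\<dots> \<le> (5 / sqrt (real n)) ^ n"
  proof (rule power_mono)
    \<comment> \<open>The base is \<open>sqrt (2 * pi * e) / sqrt n\<close>, and \<open>sqrt (2 * pi * e)\<close> is about \<open>4.13\<close>.\<close>
    have e: "exp (1/2::real) = sqrt (exp 1)" by (rule real_sqrt_unique[symmetric]) (auto simp: exp_double[symmetric])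
    have "exp 1 * (2 * pi) \<le> 3 * (2 * 4::real)" by (intro mult_mono exp_le) (use pi_less_4 in auto)
    then have "exp 1 * (2 * pi) \<le> 5\<^sup>2" by (simp add: algebra_simps)
    then have "sqrt (exp 1 * (2 * pi)) \<le> sqrt (5\<^sup>2)" by (simp only: real_sqrt_le_iff)
    then have "sqrt (exp 1 * (2 * pi)) \<le> 5" by simp
    then show "exp (1/2) * sqrt (2 * pi / real n) \<le> 5 / sqrt (real n)"
      unfolding e real_sqrt_mult[symmetric] times_divide_eq_right real_sqrt_divide by (rule divide_right_mono) simp
  qed auto
  finally show ?thesis .
qed

section \<open>Two-sided bounds for the Cramer transform\<close>

text \<open>
  Take the box of side \<open>(1 - r) / sqrt n\<close> with one corner at \<open>x\<close> that extends from \<open>x\<close>, in each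
  coordinate, in the direction of the sign of \<open>\<theta>\<close>. On it the exponent is at least its value at
  \<open>x\<close>, so the Laplace transform is at least the mass of the box times \<open>exp (inner_n n \<theta> x)\<close>.
\<close>

lemma laplace_ge:
  assumes "n \<ge> 1" "L2_set x {..<n} < 1"
  shows "ennreal (exp (inner_n n \<theta> x) * ((1 - L2_set x {..<n}) / 5) ^ n)
    \<le> (\<integral>\<^sup>+y. ennreal (exp (inner_n n \<theta> y)) \<partial>ball_measure n)"
proof -
  define h where "h = (1 - L2_set x {..<n}) / sqrt (real n)"
  have h: "h > 0" using assms by (simp add: h_def)
  define a where "a i = (if \<theta> i \<ge> 0 then x i else x i - h)" for i
  define b where "b i = a i + h" for i
  define S where "S = PiE {..<n} (\<lambda>i. {a i..b i})"
  have S_ball: "S \<subseteq> ball2 n"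
    unfolding S_def using assms h
    by (intro box_subset_ball2[where h = h and x = x]) (auto simp: h_def[symmetric] a_def b_def)
  have S_sets [measurable]: "S \<in> sets (lborel_n n)" unfolding S_def by (rule box_sets)
  have S_measure: "emeasure (lborel_n n) S = ennreal (h ^ n)"
    unfolding S_def using h by (intro emeasure_box) (auto simp: b_def)
  have inner_ge: "inner_n n \<theta> x \<le> inner_n n \<theta> y" if "y \<in> S" for y
    unfolding inner_n_def
  proof (rule sum_mono)
    fix i assume "i \<in> {..<n}"
    then have "a i \<le> y i" "y i \<le> b i" using that by (auto simp: S_def PiE_iff)
    then show "\<theta> i * x i \<le> \<theta> i * y i"
      by (cases "\<theta> i \<ge> 0") (auto simp: a_def b_def intro: mult_left_mono mult_left_mono_neg)
  qed
  have "exp (inner_n n \<theta> x) * ((1 - L2_set x {..<n}) / 5) ^ n =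
      exp (inner_n n \<theta> x) * h ^ n / (5 / sqrt (real n)) ^ n"
    using assms by (simp add: h_def field_simps power_divide)
  also have "\<dots> \<le> exp (inner_n n \<theta> x) * h ^ n / unit_ball_vol (real n)"
    using h assms(1) unit_ball_vol_le[OF assms(1)] unit_ball_vol_of_nat_pos[of n]
    by (intro divide_left_mono mult_pos_pos zero_less_power) auto
  finally have "ennreal (exp (inner_n n \<theta> x) * ((1 - L2_set x {..<n}) / 5) ^ n) \<le>
      ennreal (exp (inner_n n \<theta> x) * h ^ n / unit_ball_vol (real n))"
    by (rule ennreal_leI)
  also have "\<dots> = ennreal (exp (inner_n n \<theta> x)) * emeasure (lborel_n n) S / ennreal (unit_ball_vol (real n))"
    using h unit_ball_vol_of_nat_pos[of n] by (simp add: S_measure divide_ennreal ennreal_mult[symmetric])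
  also have "ennreal (exp (inner_n n \<theta> x)) * emeasure (lborel_n n) S =
      (\<integral>\<^sup>+y. ennreal (exp (inner_n n \<theta> x)) * indicator S y \<partial>lborel_n n)"
    by (rule nn_integral_cmult_indicator[symmetric]) measurable
  also have "\<dots> \<le> (\<integral>\<^sup>+y. ennreal (exp (inner_n n \<theta> y)) * indicator (ball2 n) y \<partial>lborel_n n)"
    using S_ball inner_ge by (intro nn_integral_mono) (auto split: split_indicator intro!: ennreal_leI)
  also have "\<dots> / ennreal (unit_ball_vol (real n)) = (\<integral>\<^sup>+y. ennreal (exp (inner_n n \<theta> y)) \<partial>ball_measure n)"
    by (rule nn_integral_ball_measure[symmetric]) measurable
  finally show ?thesis by (simp add: divide_right_mono_ennreal)
qed

text \<open>
  For a unit vector \<open>u\<close> and \<open>y\<close> in the ball, expanding \<open>\<bar>y - u\<bar>\<^sup>2\<close> gives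
  \<open>inner_n n u y \<le> 1 - \<bar>y - u\<bar>\<^sup>2 / 2\<close>. So the exponential is dominated by a Gaussian centred at
  \<open>u\<close>, whose integral over the whole space is a product of one-dimensional ones.
\<close>

lemma laplace_le:
  assumes "n \<ge> 1" "\<sigma> > 0" "L2_set u {..<n} = 1"
  shows "(\<integral>\<^sup>+y. ennreal (exp (\<sigma> * inner_n n u y)) \<partial>ball_measure n)
    \<le> ennreal (exp \<sigma> * sqrt (8 * real n / \<sigma>) ^ n)"
proof -
  have u: "(\<Sum>i<n. (u i)\<^sup>2) = 1" using assms(3) by (simp add: L2_set_def)
  have pw: "\<sigma> * inner_n n u y \<le> \<sigma> - \<sigma> * (\<Sum>i<n. (y i - u i)\<^sup>2) / 2" if "y \<in> ball2 n" for y
  proof -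
    have y: "(\<Sum>i<n. (y i)\<^sup>2) \<le> 1" using that by (simp add: ball2_L2_set L2_set_def)
    have "(\<Sum>i<n. (y i - u i)\<^sup>2) = (\<Sum>i<n. (y i)\<^sup>2) + (\<Sum>i<n. (u i)\<^sup>2) - 2 * inner_n n u y"
      by (simp add: inner_n_def power2_diff sum.distrib sum_subtractf sum_distrib_left algebra_simps)
    then have "inner_n n u y \<le> 1 - (\<Sum>i<n. (y i - u i)\<^sup>2) / 2" using u y by linarith
    then have "\<sigma> * inner_n n u y \<le> \<sigma> * (1 - (\<Sum>i<n. (y i - u i)\<^sup>2) / 2)"
      using assms by (intro mult_left_mono) auto
    then show ?thesis by (simp add: algebra_simps)
  qed
  have "(\<integral>\<^sup>+y. ennreal (exp (\<sigma> * inner_n n u y)) \<partial>ball_measure n) =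
    (\<integral>\<^sup>+y. ennreal (exp (\<sigma> * inner_n n u y)) * indicator (ball2 n) y \<partial>lborel_n n) /
      ennreal (unit_ball_vol (real n))"
    by (rule nn_integral_ball_measure) measurable
  also have "(\<integral>\<^sup>+y. ennreal (exp (\<sigma> * inner_n n u y)) * indicator (ball2 n) y \<partial>lborel_n n) \<le>
      (\<integral>\<^sup>+y. ennreal (exp \<sigma>) * ennreal (exp (- (\<sigma> * (\<Sum>i<n. (y i - u i)\<^sup>2) / 2))) \<partial>lborel_n n)"
    using pw by (intro nn_integral_mono)
      (auto split: split_indicator simp: ennreal_mult[symmetric] exp_add[symmetric] intro!: ennreal_leI)
  also have "\<dots> = ennreal (exp \<sigma> * sqrt (2 * pi / \<sigma>) ^ n)"
    using assms(2) nn_integral_gaussian_n[of \<sigma> n u]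
    by (subst nn_integral_cmult) (auto simp: lborel_n_def ennreal_mult)
  also have "\<dots> / ennreal (unit_ball_vol (real n)) =
      ennreal (exp \<sigma> * sqrt (2 * pi / \<sigma>) ^ n / unit_ball_vol (real n))"
    using assms(2) unit_ball_vol_of_nat_pos[of n] by (intro divide_ennreal) auto
  also have "\<dots> \<le> ennreal (exp \<sigma> * sqrt (8 * real n / \<sigma>) ^ n)"
  proof (rule ennreal_leI)
    have "exp \<sigma> * sqrt (2 * pi / \<sigma>) ^ n / unit_ball_vol (real n) \<le>
        exp \<sigma> * sqrt (2 * pi / \<sigma>) ^ n / (1 / sqrt (real n)) ^ n"
      using assms unit_ball_vol_ge[OF assms(1)] unit_ball_vol_of_nat_pos[of n] by (intro divide_left_mono) auto
    also have "\<dots> = exp \<sigma> * sqrt (2 * pi * real n / \<sigma>) ^ n"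
      by (simp add: power_divide real_sqrt_mult real_sqrt_divide power_mult_distrib)
    also have "\<dots> \<le> exp \<sigma> * sqrt (8 * real n / \<sigma>) ^ n"
      using pi_less_4 assms by (intro mult_left_mono power_mono real_sqrt_le_mono divide_right_mono mult_right_mono) auto
    finally show "exp \<sigma> * sqrt (2 * pi / \<sigma>) ^ n / unit_ball_vol (real n) \<le> exp \<sigma> * sqrt (8 * real n / \<sigma>) ^ n" .
  qed
  finally show ?thesis by (simp add: divide_right_mono_ennreal)
qed

lemma cramer_transform_le:
  assumes "n \<ge> 1" "L2_set x {..<n} < 1"
  shows "cramer_transform n (ball_measure n) x \<le> ereal (real n * ln (5 / (1 - L2_set x {..<n})))"
  unfolding cramer_transform_def
proof (rule SUP_least)
  fix \<theta> assume "\<theta> \<in> space (lborel_n n)"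
  let ?Z = "\<integral>y. exp (inner_n n \<theta> y) \<partial>ball_measure n" and ?r = "L2_set x {..<n}"
  show "ereal (inner_n n \<theta> x) - log_laplace n (ball_measure n) \<theta> \<le> ereal (real n * ln (5 / (1 - ?r)))"
  proof (cases "integrable (ball_measure n) (\<lambda>y. exp (inner_n n \<theta> y))")
    case True
    then have "(\<integral>\<^sup>+y. ennreal (exp (inner_n n \<theta> y)) \<partial>ball_measure n) = ennreal ?Z"
      by (rule nn_integral_eq_integral) simp
    with laplace_ge[OF assms, of \<theta>]
    have "ennreal (exp (inner_n n \<theta> x) * ((1 - ?r) / 5) ^ n) \<le> ennreal ?Z" by simp
    then have le: "exp (inner_n n \<theta> x) * ((1 - ?r) / 5) ^ n \<le> ?Z" by (simp add: ennreal_le_iff)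
    have pos: "0 < exp (inner_n n \<theta> x) * ((1 - ?r) / 5) ^ n" using assms by simp
    have "inner_n n \<theta> x - real n * ln (5 / (1 - ?r)) = ln (exp (inner_n n \<theta> x) * ((1 - ?r) / 5) ^ n)"
      using assms by (simp add: ln_mult ln_realpow ln_div algebra_simps)
    also have "\<dots> \<le> ln ?Z" using le pos by (simp del: ln_mult)
    finally show ?thesis using True by (simp add: log_laplace_def)
  qed (simp add: log_laplace_def)
qed

lemma cramer_transform_nonneg: "cramer_transform n (ball_measure n) x \<ge> 0"
proof -
  \<comment> \<open>The value at \<open>\<theta> = 0\<close> is \<open>0\<close>.\<close>
  interpret prob_space "ball_measure n" by (rule prob_space_ball_measure)
  define z where "z = (\<lambda>i\<in>{..<n}. 0::real)"
  have z0: "inner_n n z y = 0" for y by (simp add: inner_n_def z_def)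
  have "0 = ereal (inner_n n z x) - log_laplace n (ball_measure n) z"
    unfolding log_laplace_def z0 using prob_space by (simp add: zero_ereal_def)
  also have "\<dots> \<le> cramer_transform n (ball_measure n) x"
    unfolding cramer_transform_def
    by (rule SUP_upper) (auto simp: z_def lborel_n_def space_PiM simp del: restrict_apply)
  finally show ?thesis .
qed

text \<open>
  Test the supremum with \<open>\<theta>\<close> in the direction of \<open>x\<close>. The linear term is at least
  \<open>\<bar>\<theta>\<bar> - \<bar>\<theta>\<bar> * \<delta>\<close>, and by \<open>laplace_le\<close> the logarithm subtracted from it is at most
  \<open>\<bar>\<theta>\<bar> - (n / 2) * ln (\<bar>\<theta>\<bar> / n)\<close> up to a multiple of \<open>n\<close>. With \<open>\<bar>\<theta>\<bar> = n / \<delta>\<close> the loss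
  \<open>\<bar>\<theta>\<bar> * \<delta>\<close> is only \<open>n\<close>, and the gain is \<open>(n / 2) * ln (1 / \<delta>)\<close>.
\<close>

lemma cramer_transform_ge:
  assumes "n \<ge> 1" "0 < \<delta>" "\<delta> < 1" "1 - \<delta> < L2_set x {..<n}"
  shows "cramer_transform n (ball_measure n) x \<ge> ereal (real n / 2 * (ln (1 / \<delta>) - 5))"
proof -
  define r where "r = L2_set x {..<n}"
  define \<sigma> where "\<sigma> = real n / \<delta>"
  define u where "u = (\<lambda>i. x i / r)"
  define \<theta> where "\<theta> = (\<lambda>i\<in>{..<n}. \<sigma> * u i)"
  have r: "r > 0" "1 - \<delta> < r" using assms by (auto simp: r_def)
  have \<sigma>: "\<sigma> > 0" using assms by (simp add: \<sigma>_def)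
  have "L2_set u {..<n} = L2_set x {..<n} * (1 / r)"
    unfolding u_def using L2_set_left_distrib[of "1 / r" x "{..<n}"] r by simp
  then have u1: "L2_set u {..<n} = 1" using r by (simp add: r_def)
  have \<theta>: "inner_n n \<theta> y = \<sigma> * inner_n n u y" for y
    by (simp add: inner_n_def \<theta>_def sum_distrib_left mult_ac)
  have rr: "(\<Sum>i<n. x i * x i) = r * r"
    by (simp add: r_def L2_set_def sum_nonneg power2_eq_square[symmetric])
  have ux: "inner_n n u x = r"
    using r by (simp add: inner_n_def u_def sum_divide_distrib[symmetric] rr)
  define Z where "Z = (\<integral>y. exp (inner_n n \<theta> y) \<partial>ball_measure n)"
  define B where "B = exp \<sigma> * sqrt (8 * \<delta>) ^ n"
  have "8 * real n / \<sigma> = 8 * \<delta>" using assms by (simp add: \<sigma>_def)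
  with laplace_le[OF assms(1) \<sigma> u1]
  have nn: "(\<integral>\<^sup>+y. ennreal (exp (inner_n n \<theta> y)) \<partial>ball_measure n) \<le> ennreal B" by (simp add: \<theta> B_def)
  have int: "integrable (ball_measure n) (\<lambda>y. exp (inner_n n \<theta> y))"
    by (rule integrableI_nonneg) (use nn in \<open>auto simp: less_top[symmetric] top_unique\<close>)
  have "ennreal Z \<le> ennreal B" using nn nn_integral_eq_integral[OF int] by (simp add: Z_def)
  moreover have "B > 0" using assms by (simp add: B_def)
  ultimately have "Z \<le> B" by (simp add: ennreal_le_iff)
  \<comment> \<open>Monotonicity of \<open>ln\<close> needs \<open>Z > 0\<close>; the lower bound at the centre of the ball provides it.\<close>
  have "(0::ennreal) < ennreal (exp (inner_n n \<theta> (\<lambda>_. 0)) * (1 / 5) ^ n)" by simp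
  also have "\<dots> \<le> (\<integral>\<^sup>+y. ennreal (exp (inner_n n \<theta> y)) \<partial>ball_measure n)"
    using laplace_ge[of n "\<lambda>_. 0" \<theta>] assms by (simp add: L2_set_constant)
  also have "\<dots> = ennreal Z" using nn_integral_eq_integral[OF int] by (simp add: Z_def)
  finally have "Z > 0" by simp
  have "exp 1 ^ 3 \<ge> (2::real) ^ 3" using exp_ge_add_one_self[of 1] by (intro power_mono) auto
  then have "(8::real) \<le> exp 3" by (simp add: exp_of_nat_mult[symmetric])
  then have ln8: "ln (8::real) \<le> 3" using ln_le_cancel_iff[of 8 "exp 3::real"] by simp
  have "ln Z \<le> ln B" using \<open>Z > 0\<close> \<open>Z \<le> B\<close> by simp
  also have "ln B = \<sigma> + real n / 2 * (ln 8 - ln (1 / \<delta>))"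
    using assms by (simp add: B_def ln_mult ln_realpow ln_sqrt ln_div algebra_simps)
  also have "\<dots> \<le> \<sigma> + real n / 2 * (3 - ln (1 / \<delta>))"
    using ln8 by (intro add_left_mono mult_left_mono) auto
  finally have lnZ: "ln Z \<le> \<sigma> + real n / 2 * (3 - ln (1 / \<delta>))" .
  have "\<sigma> * (1 - \<delta>) \<le> \<sigma> * r" using r \<sigma> by (intro mult_left_mono) auto
  moreover have "\<sigma> * \<delta> = real n" using assms by (simp add: \<sigma>_def)
  ultimately have "real n / 2 * (ln (1 / \<delta>) - 5) \<le> \<sigma> * r - ln Z" using lnZ by (simp add: algebra_simps)
  then have "ereal (real n / 2 * (ln (1 / \<delta>) - 5)) \<le> ereal (inner_n n \<theta> x) - log_laplace n (ball_measure n) \<theta>"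
    using int \<theta>[of x] by (simp add: log_laplace_def Z_def[symmetric] ux)
  also have "\<dots> \<le> cramer_transform n (ball_measure n) x"
    unfolding cramer_transform_def
    by (rule SUP_upper) (auto simp: \<theta>_def lborel_n_def space_PiM simp del: restrict_apply)
  finally show ?thesis .
qed

section \<open>The law of the distance to the sphere\<close>

lemma emeasure_shell:
  assumes "0 < \<delta>" "\<delta> < 1"
  shows "emeasure (ball_measure n) {x \<in> ball2 n. 1 - \<delta> < L2_set x {..<n}} = ennreal (1 - (1 - \<delta>) ^ n)"
proof -
  interpret prob_space "ball_measure n" by (rule prob_space_ball_measure)
  let ?v = "unit_ball_vol (real n)"
  let ?C = "{x \<in> space (lborel_n n). L2_set x {..<n} \<le> 1 - \<delta>}"
  have C: "?C \<in> sets (lborel_n n)" by measurable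
  have "?C = {f. sqrt (\<Sum>i<n. (f i)\<^sup>2) \<le> 1 - \<delta>} \<inter> space (Pi\<^sub>M {..<n} (\<lambda>_. lborel))"
    by (auto simp: lborel_n_def L2_set_def)
  then have eC: "emeasure (lborel_n n) ?C = ennreal (?v * (1 - \<delta>) ^ n)"
    using emeasure_cball_aux[of "{..<n}" "1 - \<delta>"] assms by (simp add: lborel_n_def)
  have "?C \<subseteq> ball2 n" using assms by (auto simp: ball2_L2_set)
  then have "emeasure (ball_measure n) ?C = ennreal (?v * (1 - \<delta>) ^ n) / ennreal ?v"
    unfolding ball_measure_def using C
    by (simp add: emeasure_uniform_measure Int_absorb1 eC emeasure_ball2)
  also have "\<dots> = ennreal ((1 - \<delta>) ^ n)"
    using assms unit_ball_vol_of_nat_pos[of n] by (simp add: divide_ennreal unit_ball_vol_of_nat_nonzero)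
  finally have "prob ?C = (1 - \<delta>) ^ n" using assms by (simp add: measure_def)
  moreover have "prob (space (ball_measure n) - ?C) = 1 - prob ?C" using C by (intro prob_compl) simp
  moreover have "prob {x \<in> ball2 n. 1 - \<delta> < L2_set x {..<n}} = prob (space (ball_measure n) - ?C)"
    by (rule finite_measure_eq_AE) (use AE_ball_measure[of n] C in \<open>auto simp: ball2_L2_set\<close>)
  ultimately show ?thesis by (simp add: emeasure_eq_measure)
qed

lemma emeasure_shell_le:
  assumes "\<delta> > 0" "n \<ge> 1"
  shows "emeasure (ball_measure n) {x \<in> ball2 n. 1 - \<delta> < L2_set x {..<n}} \<le> ennreal (real n * \<delta>)"
proof (cases "\<delta> < 1")
  case True
  have "1 - (1 - \<delta>) ^ n \<le> real n * \<delta>" using Bernoulli_inequality[of "- \<delta>" n] True by simp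
  then show ?thesis using emeasure_shell[of \<delta> n] True assms by (simp add: ennreal_leI)
next
  case False
  interpret prob_space "ball_measure n" by (rule prob_space_ball_measure)
  have "emeasure (ball_measure n) {x \<in> ball2 n. 1 - \<delta> < L2_set x {..<n}} \<le> 1"
    by (rule emeasure_le_1)
  also have "1 * 1 \<le> real n * \<delta>" using assms False by (intro mult_mono) auto
  then have "1 \<le> ennreal (real n * \<delta>)" by simp
  finally show ?thesis .
qed

text \<open>
  The transform is infinite on the sphere, so the upper bound needs the sphere to be null: it lies
  in shells of arbitrarily small probability.
\<close>

lemma AE_L2_set_lt_1:
  assumes "n \<ge> 1" shows "AE x in ball_measure n. L2_set x {..<n} < 1"
proof -
  interpret prob_space "ball_measure n" by (rule prob_space_ball_measure)
  define S where "S = {x \<in> ball2 n. L2_set x {..<n} = 1}"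
  have S [measurable]: "S \<in> sets (ball_measure n)"
    unfolding S_def ball2_L2_set by simp
  have "prob S = 0"
  proof (rule ccontr)
    assume "prob S \<noteq> 0"
    then have pos: "prob S > 0" by (simp add: zero_less_measure_iff)
    \<comment> \<open>At this width the shell has at most half the probability of \<open>S\<close>.\<close>
    define \<delta> where "\<delta> = prob S / (2 * real n)"
    have \<delta>: "\<delta> > 0" using pos assms by (simp add: \<delta>_def)
    have "emeasure (ball_measure n) S \<le> emeasure (ball_measure n) {x \<in> ball2 n. 1 - \<delta> < L2_set x {..<n}}"
      by (rule emeasure_mono) (use \<delta> in \<open>auto simp: S_def ball2_L2_set\<close>)
    also have "\<dots> \<le> ennreal (real n * \<delta>)" by (rule emeasure_shell_le[OF \<delta> assms])
    finally have "prob S \<le> real n * \<delta>" using \<delta> by (simp add: emeasure_eq_measure ennreal_le_iff)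
    then show False using pos assms by (simp add: \<delta>_def)
  qed
  then have "AE x in ball_measure n. x \<notin> S"
    using S by (intro AE_not_in) (simp add: null_sets_def emeasure_eq_measure)
  with AE_ball_measure[of n] show ?thesis
    by eventually_elim (auto simp: S_def ball2_L2_set)
qed

section \<open>The norm from below\<close>

lemma ennreal_powr_ennreal: "a \<ge> 0 \<Longrightarrow> ennreal_powr (ennreal a) p = ennreal (a powr p)"
  by (simp add: ennreal_powr_def)

lemma ennreal_powr_mono:
  assumes "x \<le> y" "p \<ge> 0" shows "ennreal_powr x p \<le> ennreal_powr y p"
proof (cases "y = \<infinity>")
  case False
  then have "x \<noteq> \<infinity>" using assms by (auto simp: top_unique)
  with False assms show ?thesis
    by (auto simp: ennreal_powr_def less_top[symmetric] intro!: ennreal_leI powr_mono2 enn2real_mono)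
qed (simp add: ennreal_powr_def)

text \<open>
  Markov's inequality. The measure of \<open>S\<close> enters through a lower bound \<open>b\<close> for its \<open>p\<close>-th root,
  because for shells of width exponentially small in \<open>p\<close> this root has a positive lower bound that
  is independent of \<open>p\<close>.
\<close>

lemma Lp_norm_ge_Markov:
  assumes "p > 0" "a \<ge> 0" "b \<ge> 0" "S \<in> sets \<mu>" "\<And>x. x \<in> S \<Longrightarrow> ereal a \<le> \<bar>f x\<bar>"
    and "ennreal (b powr p) \<le> emeasure \<mu> S"
  shows "ennreal (a * b) \<le> Lp_norm p \<mu> f"
proof -
  have "ennreal ((a * b) powr p) = ennreal (a powr p) * ennreal (b powr p)"
    using assms by (simp add: powr_mult ennreal_mult)
  also have "\<dots> \<le> ennreal (a powr p) * emeasure \<mu> S" by (rule mult_left_mono) (use assms in auto)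
  also have "\<dots> = (\<integral>\<^sup>+x. ennreal (a powr p) * indicator S x \<partial>\<mu>)"
    using assms(4) by (rule nn_integral_cmult_indicator[symmetric])
  also have "\<dots> \<le> (\<integral>\<^sup>+x. ennreal_powr (e2ennreal \<bar>f x\<bar>) p \<partial>\<mu>)"
  proof (rule nn_integral_mono)
    fix x
    show "ennreal (a powr p) * indicator S x \<le> ennreal_powr (e2ennreal \<bar>f x\<bar>) p"
    proof (cases "x \<in> S")
      case True
      have "ennreal a \<le> e2ennreal \<bar>f x\<bar>"
        using e2ennreal_mono[OF assms(5)[OF True]] by simp
      then show ?thesis
        using True assms ennreal_powr_mono[of "ennreal a" _ p] by (simp add: ennreal_powr_ennreal)
    qed simp
  qed
  finally have "ennreal_powr (ennreal ((a * b) powr p)) (1 / p) \<le> Lp_norm p \<mu> f"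
    unfolding Lp_norm_def using assms by (intro ennreal_powr_mono) auto
  then show ?thesis using assms by (simp add: ennreal_powr_ennreal powr_powr)
qed

text \<open>
  The shell of width \<open>exp (-8 * p) / n\<close> has probability of order \<open>exp (-8 * p)\<close>, whose \<open>p\<close>-th root
  is bounded below, and on it the transform is of order \<open>n * (ln n + p)\<close>. The factor \<open>8\<close> in the
  exponent makes \<open>8 * p - 5 \<ge> p\<close>, which absorbs the constant in \<open>cramer_transform_ge\<close>.
\<close>

lemma Lp_norm_cramer_ge:
  assumes "n \<ge> 1" "p \<ge> 1"
  shows "ennreal (exp (-8) / 4 * real n * (ln (real n) + p))
    \<le> Lp_norm p (ball_measure n) (cramer_transform n (ball_measure n))"
proof -
  define \<delta> where "\<delta> = exp (-8 * p) / real n"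
  define a where "a = real n / 2 * (ln (real n) + p)"
  define S where "S = {x \<in> ball2 n. 1 - \<delta> < L2_set x {..<n}}"
  have e1: "exp (-8 * p) < 1" using assms by simp
  have \<delta>: "\<delta> > 0" "\<delta> < 1" "real n * \<delta> = exp (-8 * p)"
    using assms less_le_trans[OF e1, of "real n"] by (auto simp: \<delta>_def)
  have S: "S \<in> sets (ball_measure n)" unfolding S_def ball2_L2_set by simp
  have a0: "a \<ge> 0" using assms by (simp add: a_def)
  have fa: "ereal a \<le> \<bar>cramer_transform n (ball_measure n) x\<bar>" if "x \<in> S" for x
  proof -
    have "ln (1 / \<delta>) = ln (real n) + 8 * p" using assms by (simp add: \<delta>_def ln_div)
    then have "a \<le> real n / 2 * (ln (1 / \<delta>) - 5)"
      unfolding a_def using assms by (intro mult_left_mono) auto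
    then have "ereal a \<le> ereal (real n / 2 * (ln (1 / \<delta>) - 5))" by simp
    also have "\<dots> \<le> cramer_transform n (ball_measure n) x"
      using that \<delta> assms by (intro cramer_transform_ge) (auto simp: S_def)
    also have "\<dots> \<le> \<bar>cramer_transform n (ball_measure n) x\<bar>"
      using cramer_transform_nonneg[of n x] by simp
    finally show ?thesis .
  qed
  have "(exp (-8) / 2) powr p = exp (-8 * p) * (1 / 2) powr p"
    by (simp add: powr_divide exp_powr_real mult.commute powr_minus_divide)
  also have "\<dots> \<le> exp (-8 * p) * (1 / 2) powr 1"
    using assms by (intro mult_left_mono powr_mono') auto
  also have "\<dots> \<le> 1 - (1 - \<delta>) ^ n"
  proof -
    define t where "t = real n * \<delta>"
    have t: "0 < t" "t \<le> 1" using \<delta> e1 assms by (auto simp: t_def)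
    have "(1 - \<delta>) ^ n \<le> exp (- \<delta>) ^ n"
      using \<delta> exp_ge_add_one_self[of "- \<delta>"] by (intro power_mono) auto
    also have "\<dots> = 1 / exp t" by (simp add: t_def exp_of_nat_mult exp_minus power_inverse divide_inverse)
    also have "\<dots> \<le> 1 / (1 + t)" using t exp_ge_add_one_self[of t] by (intro divide_left_mono) auto
    also have "\<dots> \<le> 1 - t / 2"
    proof -
      have "t * t \<le> t * 1" using t by (intro mult_left_mono) auto
      then have "1 \<le> (1 - t / 2) * (1 + t)" by (simp add: algebra_simps)
      then show ?thesis using t by (simp add: divide_le_eq)
    qed
    finally show ?thesis using \<delta>(3) by (simp add: t_def)
  qed
  finally have "ennreal ((exp (-8) / 2) powr p) \<le> ennreal (1 - (1 - \<delta>) ^ n)" by (rule ennreal_leI)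
  also have "\<dots> = emeasure (ball_measure n) S"
    unfolding S_def using \<delta> by (intro emeasure_shell[symmetric])
  finally have "ennreal (a * (exp (-8) / 2)) \<le> Lp_norm p (ball_measure n) (cramer_transform n (ball_measure n))"
    using assms a0 S fa by (intro Lp_norm_ge_Markov[where S = S]) auto
  then show ?thesis by (simp add: a_def algebra_simps)
qed

section \<open>The norm from above\<close>

text \<open>
  This trades a \<open>p\<close>-th moment for one exponential moment. The scale \<open>2 * A\<close>, rather than \<open>A\<close>, is
  what produces \<open>exp (z / 2)\<close>: with \<open>z = ln (5 / (1 - r))\<close> this is a multiple of
  \<open>(1 - r) powr (- 1 / 2)\<close>, which is integrable on the ball, while \<open>1 / (1 - r)\<close> is not.
\<close>

lemma powr_le_one_plus_exp:
  fixes z A p :: real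
  assumes "z \<ge> 0" "p \<ge> 0" "p \<le> A" "A > 0"
  shows "(z / (2 * A)) powr p \<le> 1 + exp (z / 2 - A)"
proof (cases "z \<le> 2 * A")
  case True
  then have "(z / (2 * A)) powr p \<le> 1 powr p" using assms by (intro powr_mono2) auto
  then show ?thesis using exp_ge_zero[of "z / 2 - A"] by (simp del: exp_ge_zero)
next
  case False
  have "z / (2 * A) \<le> exp (z / (2 * A) - 1)" using exp_ge_add_one_self[of "z / (2 * A) - 1"] by simp
  then have "(z / (2 * A)) powr p \<le> exp (z / (2 * A) - 1) powr p"
    using assms by (intro powr_mono2) auto
  also have "\<dots> = exp (p / A * (z / 2 - A))"
    using assms by (simp add: exp_powr_real field_simps)
  also have "p / A * (z / 2 - A) \<le> 1 * (z / 2 - A)"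
    using assms False by (intro mult_right_mono) auto
  finally show ?thesis by simp
qed

text \<open>
  A layer decomposition, so that the expectation of the left-hand side can be read off from the
  probabilities of shells. The ratio \<open>4\<close> of the levels turns into the ratio \<open>2\<close> of the values, and
  the summand \<open>1\<close> covers \<open>s = 1\<close>.
\<close>

lemma inverse_sqrt_le_dyadic:
  fixes s :: real
  assumes "0 < s" "s \<le> 1"
  shows "ennreal (1 / sqrt s) \<le> 1 + (\<Sum>k. ennreal (2 ^ Suc k) * indicator {..<(1 / 4) ^ k} s)"
proof (cases "s = 1")
  case False
  define m where "m = (LEAST m. (1 / 4) ^ m \<le> s)"
  have "\<exists>m. (1 / 4) ^ m \<le> s" using real_arch_pow_inv[of s "1/4"] assms by (auto intro: less_imp_le)
  then have m: "(1 / 4) ^ m \<le> s" unfolding m_def by (rule LeastI_ex)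
  then have "m \<noteq> 0" using assms False by (intro notI) simp
  then obtain k where k: "m = Suc k" by (cases m) auto
  then have "\<not> (1 / 4) ^ k \<le> s" unfolding m_def by (metis lessI not_less_Least)
  then have ks: "s < (1 / 4) ^ k" by simp
  have "sqrt ((1 / 4) ^ m) = (1 / 2) ^ m" by (simp add: real_sqrt_power real_sqrt_divide)
  with m have "(1 / 2) ^ m \<le> sqrt s" by (metis real_sqrt_le_iff)
  then have "1 / sqrt s \<le> 1 / (1 / 2) ^ m" using assms by (intro divide_left_mono) auto
  then have "ennreal (1 / sqrt s) \<le> ennreal (2 ^ Suc k)" by (intro ennreal_leI) (simp add: k power_one_over)
  also have "\<dots> = ennreal (2 ^ Suc k) * indicator {..<(1 / 4) ^ k} s" using ks by simp
  also have "\<dots> = (\<Sum>k\<in>{k}. ennreal (2 ^ Suc k) * indicator {..<(1 / 4) ^ k} s)"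
    by (subst sum.insert) auto
  also have "\<dots> \<le> (\<Sum>k. ennreal (2 ^ Suc k) * indicator {..<(1 / 4) ^ k} s)"
    by (rule sum_le_suminf) auto
  finally show ?thesis by (simp add: add_increasing)
qed simp

lemma nn_integral_inverse_sqrt_le:
  assumes "n \<ge> 1"
  shows "(\<integral>\<^sup>+x. ennreal (1 / sqrt (1 - L2_set x {..<n})) \<partial>ball_measure n) \<le> ennreal (5 * real n)"
proof -
  interpret prob_space "ball_measure n" by (rule prob_space_ball_measure)
  define S where "S k = {x \<in> ball2 n. 1 - (1 / 4) ^ k < L2_set x {..<n}}" for k :: nat
  have S [measurable]: "S k \<in> sets (ball_measure n)" for k unfolding S_def ball2_L2_set by simp
  have "(\<integral>\<^sup>+x. ennreal (1 / sqrt (1 - L2_set x {..<n})) \<partial>ball_measure n)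
    \<le> (\<integral>\<^sup>+x. 1 + (\<Sum>k. ennreal (2 ^ Suc k) * indicator (S k) x) \<partial>ball_measure n)"
  proof (rule nn_integral_mono_AE)
    from AE_ball_measure[of n] AE_L2_set_lt_1[OF assms]
    show "AE x in ball_measure n. ennreal (1 / sqrt (1 - L2_set x {..<n}))
      \<le> 1 + (\<Sum>k. ennreal (2 ^ Suc k) * indicator (S k) x)"
    proof eventually_elim
      case (elim x)
      have "indicator (S k) x = (indicator {..<(1 / 4) ^ k} (1 - L2_set x {..<n}) :: ennreal)" for k
        using elim by (auto simp: S_def indicator_def)
      then show ?case using inverse_sqrt_le_dyadic[of "1 - L2_set x {..<n}"] elim by simp
    qed
  qed
  also have "\<dots> = 1 + (\<Sum>k. \<integral>\<^sup>+x. ennreal (2 ^ Suc k) * indicator (S k) x \<partial>ball_measure n)"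
    by (subst nn_integral_add, measurable, subst nn_integral_suminf) (use emeasure_space_1 in auto)
  also have "\<dots> \<le> 1 + (\<Sum>k. ennreal (2 * real n * (1 / 2) ^ k))"
  proof (intro add_left_mono suminf_le)
    fix k
    have "(\<integral>\<^sup>+x. ennreal (2 ^ Suc k) * indicator (S k) x \<partial>ball_measure n) =
        ennreal (2 ^ Suc k) * emeasure (ball_measure n) (S k)"
      by (rule nn_integral_cmult_indicator) measurable
    also have "\<dots> \<le> ennreal (2 ^ Suc k) * ennreal (real n * (1 / 4) ^ k)"
      unfolding S_def using assms by (intro mult_left_mono emeasure_shell_le) auto
    also have "\<dots> = ennreal (2 * real n * (2 * (1 / 4)) ^ k)"
      by (subst ennreal_mult[symmetric]) (simp_all only: power_mult_distrib power_Suc mult_ac, simp_all)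
    finally show "(\<integral>\<^sup>+x. ennreal (2 ^ Suc k) * indicator (S k) x \<partial>ball_measure n)
      \<le> ennreal (2 * real n * (1 / 2) ^ k)" by simp
  qed auto
  also have "(\<Sum>k. ennreal (2 * real n * (1 / 2) ^ k)) = ennreal (4 * real n)"
  proof (rule suminf_ennreal_eq)
    have "(\<lambda>k. 2 * real n * (1 / 2) ^ k) sums (2 * real n * (1 / (1 - 1 / 2)))"
      by (intro sums_mult geometric_sums) simp
    then show "(\<lambda>k. 2 * real n * (1 / 2) ^ k) sums (4 * real n)" by simp
  qed simp
  also have "1 + ennreal (4 * real n) = ennreal (1 + 4 * real n)" by (subst ennreal_plus) auto
  also have "\<dots> \<le> ennreal (5 * real n)" using assms by (intro ennreal_leI) auto
  finally show ?thesis .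
qed

text \<open>
  With \<open>A = ln n + p\<close> the \<open>p\<close>-th moment is at most \<open>(2 * n * A) powr p\<close> times
  \<open>1 + C * exp (- A) * n\<close>, and \<open>exp (- A) * n = exp (- p)\<close>: the term \<open>ln n\<close> in \<open>A\<close> is exactly what
  cancels the factor \<open>n\<close> in the expectation of \<open>(1 - r) powr (- 1 / 2)\<close>.
\<close>

lemma Lp_norm_cramer_le:
  assumes "n \<ge> 1" "p \<ge> 1"
  shows "Lp_norm p (ball_measure n) (cramer_transform n (ball_measure n))
    \<le> ennreal (18 * real n * (ln (real n) + p))"
proof -
  interpret prob_space "ball_measure n" by (rule prob_space_ball_measure)
  define A where "A = ln (real n) + p"
  have A: "A \<ge> p" "A > 0" using assms by (auto simp: A_def add_nonneg_pos)
  define D where "D = (2 * real n * A) powr p"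
  have D: "D \<ge> 0" by (simp add: D_def)
  have "(\<integral>\<^sup>+x. ennreal_powr (e2ennreal \<bar>cramer_transform n (ball_measure n) x\<bar>) p \<partial>ball_measure n)
    \<le> (\<integral>\<^sup>+x. ennreal D * (1 + ennreal (sqrt 5 * exp (- A)) * ennreal (1 / sqrt (1 - L2_set x {..<n}))) \<partial>ball_measure n)"
  proof (rule nn_integral_mono_AE)
    from AE_L2_set_lt_1[OF assms(1)]
    show "AE x in ball_measure n. ennreal_powr (e2ennreal \<bar>cramer_transform n (ball_measure n) x\<bar>) p
      \<le> ennreal D * (1 + ennreal (sqrt 5 * exp (- A)) * ennreal (1 / sqrt (1 - L2_set x {..<n})))"
    proof eventually_elim
      case (elim x)
      define s where "s = 1 - L2_set x {..<n}"
      define z where "z = ln (5 / s)"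
      have s: "0 < s" "s \<le> 1" using elim by (auto simp: s_def)
      then have z: "z \<ge> 0" by (simp add: z_def)
      have "e2ennreal \<bar>cramer_transform n (ball_measure n) x\<bar> \<le> e2ennreal (ereal (real n * z))"
        using cramer_transform_nonneg[of n x] cramer_transform_le[OF assms(1) elim]
        by (intro e2ennreal_mono) (simp add: z_def s_def)
      also have "\<dots> = ennreal (real n * z)" by simp
      finally have bound: "ennreal_powr (e2ennreal \<bar>cramer_transform n (ball_measure n) x\<bar>) p \<le>
          ennreal_powr (ennreal (real n * z)) p"
        using assms by (intro ennreal_powr_mono) auto
      have "real n * z = (2 * real n * A) * (z / (2 * A))" using A by simp
      also have "\<dots> powr p = D * (z / (2 * A)) powr p"
        unfolding D_def using A z by (intro powr_mult)
      also have "\<dots> \<le> D * (1 + exp (z / 2 - A))"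
        using A D z assms by (intro mult_left_mono powr_le_one_plus_exp) auto
      also have "exp (z / 2 - A) = sqrt 5 * exp (- A) * (1 / sqrt s)"
      proof -
        have "exp (z / 2) = sqrt (exp z)" by (rule real_sqrt_unique[symmetric]) (auto simp: exp_double[symmetric])
        also have "exp z = 5 / s" using s by (simp add: z_def)
        finally show ?thesis using exp_add[of "z / 2" "- A"] by (simp add: real_sqrt_divide)
      qed
      finally have "ennreal ((real n * z) powr p) \<le>
          ennreal (D * (1 + sqrt 5 * exp (- A) * (1 / sqrt s)))"
        by (rule ennreal_leI)
      also have "\<dots> = ennreal D * (1 + ennreal (sqrt 5 * exp (- A)) * ennreal (1 / sqrt s))"
        using s D by (subst ennreal_mult[symmetric], simp, simp, subst ennreal_1[symmetric],
          subst ennreal_plus[symmetric], simp, simp, subst ennreal_mult[symmetric]) auto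
      finally show ?case using bound z by (simp add: s_def[symmetric] ennreal_powr_ennreal)
    qed
  qed
  also have "\<dots> = ennreal D * (1 + ennreal (sqrt 5 * exp (- A)) *
      (\<integral>\<^sup>+x. ennreal (1 / sqrt (1 - L2_set x {..<n})) \<partial>ball_measure n))"
    using emeasure_space_1 by (simp add: nn_integral_cmult nn_integral_add)
  also have "\<dots> \<le> ennreal D * (1 + ennreal (sqrt 5 * exp (- A)) * ennreal (5 * real n))"
    by (intro mult_left_mono add_left_mono nn_integral_inverse_sqrt_le assms) auto
  also have "\<dots> = ennreal (D * (1 + sqrt 5 * exp (- A) * (5 * real n)))"
    using D by (simp add: ennreal_mult ennreal_plus)
  also have "\<dots> \<le> ennreal (D * 9)"
  proof (intro ennreal_leI mult_left_mono D)
    have "2 \<le> exp p" using exp_ge_add_one_self[of p] assms by linarith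
    then have "exp (- p) \<le> 1 / 2" by (simp add: exp_minus field_simps)
    have "exp (- A) * real n = exp (- p)" using assms by (simp add: A_def exp_diff exp_minus divide_inverse)
    moreover have "sqrt 5 \<le> sqrt (3\<^sup>2)" by (subst real_sqrt_le_iff) simp
    ultimately have "sqrt 5 * (exp (- A) * real n) \<le> 3 * (1 / 2)"
      using \<open>exp (- p) \<le> 1 / 2\<close> by (intro mult_mono) auto
    then show "1 + sqrt 5 * exp (- A) * (5 * real n) \<le> 9" by simp
  qed
  also have "\<dots> \<le> ennreal (D * 9 powr p)"
    using D assms powr_mono[of 1 p 9] by (intro ennreal_leI mult_left_mono) auto
  also have "D * 9 powr p = (18 * real n * A) powr p"
    unfolding D_def using A by (subst powr_mult[symmetric]) (auto simp: mult_ac)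
  finally have "Lp_norm p (ball_measure n) (cramer_transform n (ball_measure n)) \<le>
      ennreal_powr (ennreal ((18 * real n * A) powr p)) (1 / p)"
    unfolding Lp_norm_def using assms by (intro ennreal_powr_mono) auto
  also have "\<dots> = ennreal (18 * real n * A)"
    using A assms by (simp add: ennreal_powr_ennreal powr_powr)
  finally show ?thesis by (simp add: A_def)
qed

section \<open>The two-sided estimate\<close>

theorem proposition6p2:
  shows "\<exists>c1 c2 :: real. c1 > 0 \<and> c2 > 0 \<and>
    (\<forall>(n::nat) (p::real). n \<ge> 1 \<longrightarrow> p \<ge> 1 \<longrightarrow>
      ennreal (c1 * real n * (ln (real n) + p))
        \<le> Lp_norm p (ball_measure n) (cramer_transform n (ball_measure n)) \<and>
      Lp_norm p (ball_measure n) (cramer_transform n (ball_measure n))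
        \<le> ennreal (c2 * real n * (ln (real n) + p)))"
proof (intro exI conjI allI impI)
  show "exp (-8) / 4 > (0::real)" "18 > (0::real)" by auto
qed (rule Lp_norm_cramer_ge Lp_norm_cramer_le; assumption)+

end
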